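(* Let $S\subseteq\mathbb R$ be an interval and let $w,p:S\to(0,\infty)$ and $q:S\to\mathbb R$ be coefficient functions such that $w,p^{-1},q$ are locally $L^1$-integrable inside $S$. Let $T$ be a positive self-adjoint operator on $L^2(S,w(x)\,dx)$ whose action is locally given by the Sturm-Liouville expression $$Tf=\frac1w\big(-(pf')'+qf\big),\qquad f\in\mathcal D(T),$$ with endpoint conditions at the endpoints of $S$ such that $T$ is positive and self-adjoint, and with the Friedrichs condition imposed at singular endpoints. Let $t$ be the closed quadratic form associated with $T$, so that $\mathcal Q(t)=\mathcal D(T^{1/2})$. Assume that every $f\in\mathcal Q(t)$ admits a locally continuous representative on $S$. Assume moreover that $t$ is local in the following sense: whenever an element of $\mathcal Q(t)$ vanishes at finitely many interior points of $S$, its restrictions to the complementary subintervals belong to the corresponding Dirichlet form domains, and the form is additive over such finite decompositions (i.e. $t[f]$ equals the sum of the Dirichlet forms $t_I[f|_I]$ over the complementary subintervals $I$). Let $\{a_j\}\subset S$ be a finite or countable ordered family with no accumulation point in the interior of $S$, and let $I_j=(a_j,a_{j+1})$. Then $T$ is compatible with Dirichlet confinement on the intervals $I_j$: whenever $f\in\mathcal Q(t)$ has a representative with $f(a_j)=0$ at all those $a_j$ lying in the interior of $S$, one has $f|_{I_j}\in\mathcal Q(t_{I_j})$ for every $j$ and $$t[f]\ \ge\ \sum_j t_{I_j}\big[f|_{I_j}\big].$$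
   Context: For a subinterval $I\subseteq S$, $t_I$ denotes the Dirichlet restriction of $t$ to $I$: the closed non-negative quadratic form on $L^2(I,w(x)\,dx)$ obtained from $t$ by restricting the Sturm-Liouville form to $I$, imposing Dirichlet conditions (vanishing boundary values) at the finite endpoints of $I$ that lie in the interior of $S$, and imposing the endpoint condition inherited from $T$ at any endpoint of $I$ that is an endpoint of $S$. Its form domain is denoted $\mathcal Q(t_I)$; the form $t_I$ depends only on $t$ and $I$. *)

theory Defs
  imports "HOL-Analysis.Analysis"
begin

section \<open>The space \<open>L\<^sup>2(S, w dx)\<close> and operators on it\<close>

text \<open>
  Elements of \<open>L\<^sup>2\<close> are handled through representatives \<open>real \<Rightarrow> complex\<close>, of which only the values
  on the space of the measure matter. Operators are graphs (sets of pairs of representatives)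
  that are closed under a.e. equality; for self-adjoint operators this closure is automatic, since
  an adjoint graph has it.
\<close>

definition weighted :: "real set \<Rightarrow> (real \<Rightarrow> real) \<Rightarrow> real measure" where
  "weighted S w = density (lebesgue_on S) (\<lambda>x. ennreal (w x))"

definition L2 :: "real measure \<Rightarrow> (real \<Rightarrow> complex) set" where
  "L2 M = {f \<in> borel_measurable M. integrable M (\<lambda>x. (cmod (f x))\<^sup>2)}"

definition L2_inner :: "real measure \<Rightarrow> (real \<Rightarrow> complex) \<Rightarrow> (real \<Rightarrow> complex) \<Rightarrow> complex" where
  "L2_inner M f g = (LINT x|M. f x * cnj (g x))"

definition L2_norm2 :: "real measure \<Rightarrow> (real \<Rightarrow> complex) \<Rightarrow> real" where
  "L2_norm2 M f = (LINT x|M. (cmod (f x))\<^sup>2)"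

type_synonym operator = "((real \<Rightarrow> complex) \<times> (real \<Rightarrow> complex)) set"

definition densely_defined :: "real measure \<Rightarrow> operator \<Rightarrow> bool" where
  "densely_defined M A \<longleftrightarrow>
     (\<forall>f\<in>L2 M. \<forall>e>0. \<exists>h\<in>Domain A. h \<in> L2 M \<and> L2_norm2 M (\<lambda>x. f x - h x) < e)"

definition adjoint_op :: "real measure \<Rightarrow> operator \<Rightarrow> operator" where
  "adjoint_op M A =
     {(f, g). f \<in> L2 M \<and> g \<in> L2 M \<and> (\<forall>(h, k)\<in>A. L2_inner M k f = L2_inner M h g)}"

definition self_adjoint :: "real measure \<Rightarrow> operator \<Rightarrow> bool" where
  "self_adjoint M A \<longleftrightarrow> densely_defined M A \<and> A = adjoint_op M A"

definition positive_op :: "real measure \<Rightarrow> operator \<Rightarrow> bool" where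
  "positive_op M A \<longleftrightarrow> (\<forall>(f, g)\<in>A. 0 \<le> Re (L2_inner M g f))"

definition is_sqrt_op :: "real measure \<Rightarrow> operator \<Rightarrow> operator \<Rightarrow> bool" where
  "is_sqrt_op M R T \<longleftrightarrow> self_adjoint M R \<and> positive_op M R \<and> R O R = T"

text \<open>
  The closed quadratic form of a positive self-adjoint operator \<open>T\<close>: the form domain \<open>Q\<close> is
  \<open>\<D>(T\<^sup>1\<^sup>/\<^sup>2)\<close>, and \<open>t[f] = \<parallel>T\<^sup>1\<^sup>/\<^sup>2 f\<parallel>\<^sup>2\<close> for \<open>f \<in> Q\<close>; values of \<open>t\<close> off \<open>Q\<close> are irrelevant.
\<close>

definition form_of_op ::
    "real measure \<Rightarrow> operator \<Rightarrow> (real \<Rightarrow> complex) set \<Rightarrow> ((real \<Rightarrow> complex) \<Rightarrow> real) \<Rightarrow> bool" where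
  "form_of_op M T Q t \<longleftrightarrow>
     (\<exists>R. is_sqrt_op M R T \<and> Q = Domain R \<and> (\<forall>(f, g)\<in>R. t f = L2_norm2 M g))"


section \<open>Sturm--Liouville operators\<close>

definition locally_L1 :: "real set \<Rightarrow> (real \<Rightarrow> real) \<Rightarrow> bool" where
  "locally_L1 S f \<longleftrightarrow> (\<forall>a b. {a..b} \<subseteq> interior S \<longrightarrow> f absolutely_integrable_on {a..b})"

definition abs_continuous_on :: "real set \<Rightarrow> (real \<Rightarrow> complex) \<Rightarrow> bool" where
  "abs_continuous_on A f \<longleftrightarrow>
     (\<forall>e>0. \<exists>d>0. \<forall>D B. D division_of B \<and> B \<subseteq> A \<and> (\<Sum>K\<in>D. Sup K - Inf K) < d \<longrightarrow>
        (\<Sum>K\<in>D. norm (f (Sup K) - f (Inf K))) < e)"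

definition locally_AC :: "real set \<Rightarrow> (real \<Rightarrow> complex) \<Rightarrow> bool" where
  "locally_AC S f \<longleftrightarrow> (\<forall>a b. {a..b} \<subseteq> interior S \<longrightarrow> abs_continuous_on {a..b} f)"

text \<open>
  \<open>g = w\<^sup>-\<^sup>1 (-(p f')' + q f)\<close> on \<open>S\<close>: here \<open>u\<close> is the locally absolutely continuous representative
  of \<open>f\<close>, and \<open>v\<close> that of the quasi-derivative \<open>p f'\<close>.
\<close>

definition sturm_liouville ::
    "real set \<Rightarrow> (real \<Rightarrow> real) \<Rightarrow> (real \<Rightarrow> real) \<Rightarrow> (real \<Rightarrow> real) \<Rightarrow>
     (real \<Rightarrow> complex) \<Rightarrow> (real \<Rightarrow> complex) \<Rightarrow> bool" where
  "sturm_liouville S w p q f g \<longleftrightarrow>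
     (\<exists>u u' v v'. locally_AC S u \<and> locally_AC S v \<and>
        (AE x in lebesgue_on S. f x = u x \<and>
           (u has_vector_derivative u' x) (at x) \<and> v x = complex_of_real (p x) * u' x \<and>
           (v has_vector_derivative v' x) (at x) \<and>
           g x = (- v' x + complex_of_real (q x) * u x) / complex_of_real (w x)))"

text \<open>
  An endpoint is regular if it is finite and \<open>w\<close>, \<open>1/p\<close>, \<open>q\<close> are integrable up to it; otherwise it
  is singular. At a singular endpoint the Friedrichs condition says that \<open>T\<close> is, at that endpoint,
  the Friedrichs extension of its restriction to functions vanishing near the endpoint: these
  functions are dense in \<open>Q\<close> for the form norm. (At a limit-point endpoint this holds
  automatically.)
\<close>

definition regular_left where
  "regular_left S w p q \<longleftrightarrow> bdd_below S \<and>
     (\<forall>c\<in>interior S. \<forall>k\<in>{w, \<lambda>x. 1 / p x, q :: real \<Rightarrow> real}. k absolutely_integrable_on (S \<inter> {..c}))"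

definition regular_right where
  "regular_right S w p q \<longleftrightarrow> bdd_above S \<and>
     (\<forall>c\<in>interior S. \<forall>k\<in>{w, \<lambda>x. 1 / p x, q :: real \<Rightarrow> real}. k absolutely_integrable_on (S \<inter> {c..}))"

definition form_dense ::
    "real measure \<Rightarrow> (real \<Rightarrow> complex) set \<Rightarrow> ((real \<Rightarrow> complex) \<Rightarrow> real) \<Rightarrow>
     (real \<Rightarrow> complex) set \<Rightarrow> bool" where
  "form_dense M Q t D \<longleftrightarrow>
     (\<forall>f\<in>Q. \<forall>e>0. \<exists>h\<in>D. t (\<lambda>x. f x - h x) + L2_norm2 M (\<lambda>x. f x - h x) < e)"

definition friedrichs_left where
  "friedrichs_left S w T Q t \<longleftrightarrow>
     form_dense (weighted S w) Q t
       {h \<in> Domain T. \<exists>c\<in>interior S. AE x in lebesgue_on S. x < c \<longrightarrow> h x = 0}"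

definition friedrichs_right where
  "friedrichs_right S w T Q t \<longleftrightarrow>
     form_dense (weighted S w) Q t
       {h \<in> Domain T. \<exists>c\<in>interior S. AE x in lebesgue_on S. c < x \<longrightarrow> h x = 0}"


section \<open>Dirichlet restrictions and locality\<close>

definition continuous_rep :: "real set \<Rightarrow> (real \<Rightarrow> complex) \<Rightarrow> (real \<Rightarrow> complex) \<Rightarrow> bool" where
  "continuous_rep S f u \<longleftrightarrow> continuous_on S u \<and> (AE x in lebesgue_on S. f x = u x)"

definition zero_ext :: "real set \<Rightarrow> (real \<Rightarrow> complex) \<Rightarrow> real \<Rightarrow> complex" where
  "zero_ext I g = (\<lambda>x. if x \<in> I then g x else 0)"

text \<open>
  The Dirichlet restriction \<open>t\<^sub>I\<close> of a form \<open>t\<close> (with domain \<open>Q\<close>) to a subinterval \<open>I\<close> of \<open>S\<close>, as a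
  form on \<open>L\<^sup>2(I, w dx)\<close>. A function on \<open>I\<close> is evaluated in \<open>t\<close> after extension by zero, so that only
  the part of the Sturm--Liouville form living on \<open>I\<close> contributes. Membership of the extension in
  \<open>Q\<close> imposes on \<open>g\<close> the conditions of \<open>T\<close> at every endpoint shared with \<open>S\<close>; at the endpoints of \<open>I\<close>
  interior to \<open>S\<close> the boundary values vanish. Endpoints of \<open>S\<close> are never subject to the Dirichlet
  condition, whether or not they belong to \<open>S\<close> or \<open>I\<close>.
\<close>

definition dirichlet_dom ::
    "real set \<Rightarrow> (real \<Rightarrow> real) \<Rightarrow> (real \<Rightarrow> complex) set \<Rightarrow> real set \<Rightarrow> (real \<Rightarrow> complex) set" where
  "dirichlet_dom S w Q I =
     {g \<in> L2 (weighted I w). zero_ext I g \<in> Q \<and>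
        (\<exists>u. continuous_rep S (zero_ext I g) u \<and> (\<forall>c\<in>frontier I \<inter> interior S. u c = 0))}"

definition dirichlet_form ::
    "((real \<Rightarrow> complex) \<Rightarrow> real) \<Rightarrow> real set \<Rightarrow> (real \<Rightarrow> complex) \<Rightarrow> real" where
  "dirichlet_form t I g = t (zero_ext I g)"

text \<open>
  Vanishing at points refers to the continuous representative. The complementary subintervals of a
  finite set \<open>F\<close> are the connected components of \<open>S - F\<close>.
\<close>

definition local_form ::
    "real set \<Rightarrow> (real \<Rightarrow> real) \<Rightarrow> (real \<Rightarrow> complex) set \<Rightarrow> ((real \<Rightarrow> complex) \<Rightarrow> real) \<Rightarrow> bool" where
  "local_form S w Q t \<longleftrightarrow>
     (\<forall>f\<in>Q. \<forall>F. finite F \<and> F \<subseteq> interior S \<and> (\<exists>u. continuous_rep S f u \<and> (\<forall>c\<in>F. u c = 0)) \<longrightarrow>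
        (\<forall>I\<in>components (S - F). restrict f I \<in> dirichlet_dom S w Q I) \<and>
        t f = (\<Sum>I\<in>components (S - F). dirichlet_form t I (restrict f I)))"

end

theory Submission
  imports Defs
begin

text \<open>
  For finitely many of the intervals take \<open>F\<close> to be the set of those endpoints that lie in the
  interior of \<open>S\<close>. By monotonicity of the family no point of \<open>F\<close> lies inside one of the chosen
  intervals, so each of them is, up to its endpoints, a connected component of \<open>S - F\<close>; form
  domain and form do not see null sets. Locality and nonnegativity of the form then bound every
  finite partial sum by the value of the form on the whole function.
\<close>

section \<open>Components of an interval with finitely many points removed\<close>

lemma finite_components_interval_minus_finite:
  fixes S :: "real set"
  assumes S: "is_interval S" and F: "finite F"
  shows "finite (components (S - F))"
proof -
  \<comment> \<open>A component is encoded by the points of \<open>F\<close> to the left of an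
    arbitrarily picked point of it. Equal codes turn out to force equal components, so
    \<open>below\<close> injects the components into the finite set \<open>Pow F\<close>.\<close>
  define below where "below C = F \<inter> {..(SOME x. x \<in> C)}" for C :: "real set"
  have pick: "(SOME x. x \<in> C) \<in> C" if "C \<in> components (S - F)" for C
    using in_components_nonempty[OF that] by (meson ex_in_conv someI_ex)
  have sub: "C \<subseteq> D"
    if C: "C \<in> components (S - F)" and D: "D \<in> components (S - F)" and eq: "below C = below D" for C D
  proof -
    let ?x = "SOME x. x \<in> C" and ?y = "SOME x. x \<in> D"
    have x: "?x \<in> C" "?x \<in> S - F" and y: "?y \<in> D" "?y \<in> S - F"
      using pick C D in_components_subset by blast+
    \<comment> \<open>The segment stays in \<open>S\<close> by convexity. A point of
      \<open>F\<close> on it would differ from both ends, which avoid \<open>F\<close>, so it would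
      lie below exactly one of them and the codes would differ.\<close>
    have seg: "closed_segment ?x ?y \<subseteq> S - F"
    proof
      fix z assume z: "z \<in> closed_segment ?x ?y"
      then have "z \<in> S"
        using x y S by (meson DiffD1 closed_segment_subset is_interval_convex subsetD)
      moreover have "z \<notin> F"
      proof
        assume "z \<in> F"
        moreover have "z \<noteq> ?x" "z \<noteq> ?y" using x y \<open>z \<in> F\<close> by auto
        ultimately show False
          using z eq by (auto simp: below_def closed_segment_eq_real_ivl set_eq_iff split: if_splits)
            (metis antisym order_less_imp_le linorder_le_cases)+
      qed
      ultimately show "z \<in> S - F" by blast
    qed
    have "closed_segment ?x ?y \<subseteq> C" "closed_segment ?x ?y \<subseteq> D"
      using components_maximal[OF C connected_segment seg] components_maximal[OF D connected_segment seg]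
        x(1) y(1) by (metis disjoint_iff ends_in_segment)+
    then have "C \<inter> D \<noteq> {}" by (metis ends_in_segment(1) disjoint_iff subsetD)
    then show ?thesis using components_eq[OF C D] by simp
  qed
  have "inj_on below (components (S - F))"
    by (rule inj_onI) (metis sub subset_antisym)
  moreover have "below ` components (S - F) \<subseteq> Pow F" by (auto simp: below_def)
  ultimately show ?thesis using F by (meson finite_Pow_iff finite_subset finite_imageD)
qed

text \<open>If the component reached beyond \<open>b\<close> or \<open>c\<close>, that endpoint
  would lie strictly between two points of the component, hence in the interior of \<open>S\<close>
  and therefore in \<open>F\<close>, which the component avoids. The upper bound is the closed
  interval because an endpoint of the gap that is also an endpoint of \<open>S\<close> need not be
  in \<open>F\<close> and may then belong to the component.\<close>

lemma component_within_gap: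
  fixes S F :: "real set"
  assumes S: "is_interval S" and b: "b \<in> S" "c \<in> S" "b < c"
    and F: "F \<inter> {b<..<c} = {}" and F_ends: "{b, c} \<inter> interior S \<subseteq> F"
  obtains C where "C \<in> components (S - F)" "{b<..<c} \<subseteq> C" "C \<subseteq> {b..c}"
proof -
  have "{b<..<c} \<subseteq> S - F"
  proof
    fix x assume x: "x \<in> {b<..<c}"
    then have "x \<in> S" using S b unfolding is_interval_1 by (meson greaterThanLessThan_iff less_imp_le)
    then show "x \<in> S - F" using x F by blast
  qed
  moreover have "(b + c) / 2 \<in> {b<..<c}" using b by auto
  ultimately obtain C where C: "C \<in> components (S - F)" "{b<..<c} \<subseteq> C"
    by (metis exists_component_superset connected_Ioo empty_iff empty_subsetI subset_empty)
  have ends: "z \<notin> interior S" if "z \<in> {b, c}" "z \<in> C" for z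
    using that F_ends in_components_subset[OF C(1)] by blast
  have interior: "z \<in> interior S" if "x \<in> C" "y \<in> C" "x < z" "z < y" for x y z
  proof -
    have "{x<..<y} \<subseteq> S"
    proof
      fix r assume "r \<in> {x<..<y}"
      moreover have "x \<in> S" "y \<in> S" using that in_components_subset[OF C(1)] by auto
      ultimately show "r \<in> S"
        using S unfolding is_interval_1 by (meson greaterThanLessThan_iff less_imp_le)
    qed
    then show ?thesis using that by (meson greaterThanLessThan_iff interiorI open_greaterThanLessThan)
  qed
  have between: "z \<in> C" if "x \<in> C" "y \<in> C" "x \<le> z" "z \<le> y" for x y z
    using in_components_connected[OF C(1)] that by (meson connected_contains_Icc atLeastAtMost_iff subsetD)
  \<comment> \<open>The midpoint is a point of \<open>C\<close> strictly inside the gap; it is the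
    partner that traps \<open>b\<close> or \<open>c\<close> between two points of
    \<open>C\<close>.\<close>
  have m: "(b + c) / 2 \<in> C" "b < (b + c) / 2" "(b + c) / 2 < c" using C(2) b by auto
  have "C \<subseteq> {b..c}"
  proof
    fix x assume x: "x \<in> C"
    have "\<not> x < b"
      using between[OF x m(1)] interior[OF x m(1), of b] ends[of b] m by fastforce
    moreover have "\<not> c < x"
      using between[OF m(1) x] interior[OF m(1) x, of c] ends[of c] m by fastforce
    ultimately show "x \<in> {b..c}" by auto
  qed
  with C show ?thesis using that by blast
qed

section \<open>Measurability of the weight and square integrability on subintervals\<close>

lemma locally_L1_borel_measurable:
  assumes S: "is_interval S" and w: "locally_L1 S w"
  shows "w \<in> borel_measurable (lebesgue_on S)"
proof -
  \<comment> \<open>Local integrability controls \<open>w\<close> only on compact intervals inside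
    the interior. Countably many of them exhaust the interior, and what remains of \<open>S\<close>
    lies in the frontier of a convex set, which is negligible; measurability is checked piece by
    piece.\<close>
  obtain \<D> where \<D>: "countable \<D>" "\<D> \<subseteq> Pow (interior S)"
    "\<And>X. X \<in> \<D> \<Longrightarrow> \<exists>a b. X = cbox a b" "\<Union>\<D> = interior S"
    using open_countable_Union_open_cbox[OF open_interior] by metis
  have "negligible (S - interior S)"
    using negligible_convex_frontier[of S] S
    by (metis Diff_mono Diff_subset closure_subset frontier_def is_interval_convex negligible_subset order_refl)
  then have N: "S - interior S \<in> null_sets lebesgue" by (simp add: negligible_iff_null_sets)
  show ?thesis
  proof (rule measurable_piecewise_restrict)
    show "countable (insert (S - interior S) \<D>)" using \<D> by simp
    show "space (lebesgue_on S) \<subseteq> \<Union> (insert (S - interior S) \<D>)" using \<D> by auto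
  next
    fix X assume X: "X \<in> insert (S - interior S) \<D>"
    have X': "X \<subseteq> S" "X \<in> sets lebesgue"
      using X \<D> interior_subset N by (auto; fastforce)+
    then show "X \<inter> space (lebesgue_on S) \<in> sets (lebesgue_on S)"
      by (auto simp: sets_restrict_space space_restrict_space)
    have "S \<in> sets lebesgue" using S by (simp add: real_interval_borel_measurable)
    then have eq: "restrict_space (lebesgue_on S) X = lebesgue_on X"
      using X' by (simp add: restrict_restrict_space inf.absorb2)
    show "w \<in> borel_measurable (restrict_space (lebesgue_on S) X)"
    proof (cases "X \<in> \<D>")
      case True
      then obtain a b where "X = {a..b}" using \<D>(3) box_real(2) by metis
      moreover from this have "{a..b} \<subseteq> interior S" using True \<D>(2) by blast
      ultimately show ?thesis unfolding eq
        using w absolutely_integrable_measurable[of "{a..b}" w] by (simp add: locally_L1_def)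
    next
      case False
      then have "X \<in> null_sets lebesgue" using X N by auto
      \<comment> \<open>Lebesgue measure is complete, so every subset of the null piece is
        measurable and the arbitrary values of \<open>w\<close> at the ends of \<open>S\<close> do
        no harm.\<close>
      then have "B \<in> sets lebesgue" if "B \<subseteq> X" for B
        using null_sets_completion_subset[OF that] by blast
      then show ?thesis unfolding eq using X'
        by (intro measurableI) (auto simp: sets_restrict_space_iff)
    qed
  qed
qed

lemma AE_weighted:
  assumes "w \<in> borel_measurable (lebesgue_on S)" "AE x in lebesgue_on S. P x"
  shows "AE x in weighted S w. P x"
  unfolding weighted_def using assms by (subst AE_density) (auto elim: eventually_mono)

lemma AE_lebesgue_on_finite:
  assumes "finite N" "S \<in> sets lebesgue"
  shows "AE x in lebesgue_on S. x \<notin> (N :: real set)"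
proof -
  have "AE x in lebesgue. x \<notin> N"
    by (intro AE_not_in null_sets_completionI finite_imp_null_set_lborel assms)
  then show ?thesis using assms by (auto simp: AE_restrict_space_iff)
qed

lemma L2_cong_AE:
  assumes "f \<in> L2 M" "g \<in> borel_measurable M" "AE x in M. f x = g x"
  shows "g \<in> L2 M"
  using assms unfolding L2_def
  by (auto intro!: integrable_cong_AE_imp[of M "\<lambda>x. (cmod (f x))\<^sup>2"])

lemma L2_restrict:
  assumes S: "w \<in> borel_measurable (lebesgue_on S)" "\<forall>x\<in>S. 0 < w x" "S \<in> sets lebesgue"
    and I: "I \<in> sets lebesgue" "I \<subseteq> S" and f: "f \<in> L2 (weighted S w)"
  shows "restrict f I \<in> L2 (weighted I w)"
proof -
  have f_meas: "f \<in> borel_measurable (lebesgue_on S)"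
    and f_int: "integrable (density (lebesgue_on S) (\<lambda>x. ennreal (w x))) (\<lambda>x. (cmod (f x))\<^sup>2)"
    using f by (simp_all add: L2_def weighted_def)
  have eq: "lebesgue_on I = restrict_space (lebesgue_on S) I"
    using I S(3) by (simp add: restrict_restrict_space inf.absorb2)
  have w_I: "w \<in> borel_measurable (lebesgue_on I)" and f_I: "f \<in> borel_measurable (lebesgue_on I)"
    using S(1) f_meas unfolding eq by (auto intro: measurable_restrict_space1)
  have r: "restrict f I \<in> borel_measurable (lebesgue_on I)"
    using f_I by (subst measurable_cong[where g = f]) auto
  \<comment> \<open>Moving the weight from the measure into the integrand reduces the claim to
    restricting an integral with respect to Lebesgue measure from \<open>S\<close> to
    \<open>I\<close>.\<close>
  have "integrable (lebesgue_on S) (\<lambda>x. w x *\<^sub>R (cmod (f x))\<^sup>2)"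
    using f_int S f_meas by (subst (asm) integrable_density) (auto intro!: AE_I2 less_imp_le)
  then have "integrable (lebesgue_on I) (\<lambda>x. w x *\<^sub>R (cmod (f x))\<^sup>2)"
    unfolding eq using I S(3) by (subst integrable_restrict_space)
      (auto simp: sets_restrict_space_iff simp del: real_scaleR_def scaleR_scaleR intro!: integrable_mult_indicator)
  then have "integrable (lebesgue_on I) (\<lambda>x. w x *\<^sub>R (cmod (restrict f I x))\<^sup>2)"
    by (subst Bochner_Integration.integrable_cong[OF refl, where g = "\<lambda>x. w x *\<^sub>R (cmod (f x))\<^sup>2"]) auto
  then have "integrable (density (lebesgue_on I) (\<lambda>x. ennreal (w x))) (\<lambda>x. (cmod (restrict f I x))\<^sup>2)"
    using w_I r S I by (subst integrable_density) (auto intro!: AE_I2 less_imp_le simp del: restrict_apply)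
  then show ?thesis using r by (simp add: L2_def weighted_def del: restrict_apply)
qed

section \<open>Self-adjoint graphs and their forms under a.e. equality\<close>

lemma adjoint_op_subset_L2:
  assumes "(f, g) \<in> adjoint_op M A"
  shows "f \<in> L2 M" "g \<in> L2 M"
  using assms by (auto simp: adjoint_op_def)

text \<open>Membership in an adjoint graph is tested only through inner products, which do not see
  null sets; a self-adjoint graph is its own adjoint.\<close>

lemma self_adjoint_cong_AE:
  assumes R: "self_adjoint M R" "(f, g) \<in> R"
    and f': "f' \<in> borel_measurable M" "AE x in M. f x = f' x"
  shows "(f', g) \<in> R"
proof -
  have adj: "R = adjoint_op M R" using R by (simp add: self_adjoint_def)
  have "f \<in> L2 M" using R adj adjoint_op_subset_L2 by metis
  have "L2_inner M k f' = L2_inner M h g" if hk: "(h, k) \<in> R" for h k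
  proof -
    have cnj: "(\<lambda>x. cnj (h x)) \<in> borel_measurable M" if "h \<in> borel_measurable M" for h
      using measurable_compose[OF that borel_measurable_continuous_onI[OF continuous_on_cnj]] by simp
    have "k \<in> L2 M" using hk adj adjoint_op_subset_L2 by metis
    then have "L2_inner M k f = L2_inner M k f'"
      unfolding L2_inner_def using \<open>f \<in> L2 M\<close> f'
      by (intro integral_cong_AE) (auto simp: L2_def intro!: borel_measurable_times cnj)
    moreover have "(f, g) \<in> adjoint_op M R" using R(2) adj by simp
    ultimately show ?thesis using hk by (auto simp: adjoint_op_def)
  qed
  moreover have "(f, g) \<in> adjoint_op M R" using R(2) adj by simp
  ultimately have "(f', g) \<in> adjoint_op M R"
    using L2_cong_AE[OF \<open>f \<in> L2 M\<close> f'] by (auto simp: adjoint_op_def)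
  then show ?thesis using adj by simp
qed

lemma form_of_op_nonneg:
  assumes "form_of_op M T Q t" "f \<in> Q"
  shows "0 \<le> t f"
  using assms by (auto simp: form_of_op_def L2_norm2_def)

lemma form_of_op_subset_L2:
  assumes "form_of_op M T Q t"
  shows "Q \<subseteq> L2 M"
proof -
  obtain R where "self_adjoint M R" "Q = Domain R"
    using assms by (auto simp: form_of_op_def is_sqrt_op_def)
  then show ?thesis using adjoint_op_subset_L2(1)[of _ _ M R] by (auto simp: self_adjoint_def)
qed

text \<open>The square root relates both representatives to the same \<open>g\<close>, and the form
  is the squared norm of that \<open>g\<close>.\<close>

lemma form_of_op_cong_AE:
  assumes t: "form_of_op M T Q t" and f: "f \<in> Q"
    and f': "f' \<in> borel_measurable M" "AE x in M. f x = f' x"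
  shows "f' \<in> Q" "t f' = t f"
proof -
  obtain R where R: "self_adjoint M R" "Q = Domain R" "\<forall>(f, g)\<in>R. t f = L2_norm2 M g"
    using t by (auto simp: form_of_op_def is_sqrt_op_def)
  obtain g where g: "(f, g) \<in> R" using f R by auto
  then have "(f', g) \<in> R" using self_adjoint_cong_AE R f' by blast
  then have "f' \<in> Domain R" "t f' = L2_norm2 M g" "t f = L2_norm2 M g" using R(3) g by blast+
  then show "f' \<in> Q" "t f' = t f" using R(2) by simp_all
qed

section \<open>Dirichlet restrictions to a component and to the open interval inside it\<close>

lemma zero_ext_restrict [simp]: "zero_ext I (restrict f I) = zero_ext I f"
  by (auto simp: zero_ext_def)

text \<open>Locality speaks about components, which may contain an endpoint of \<open>S\<close>,
  whereas the goal concerns open intervals. The two sets differ at most in \<open>b\<close> and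
  \<open>c\<close>, so the zero extensions agree a.e. and can share one continuous
  representative.\<close>

lemma dirichlet_open_interval:
  assumes S: "is_interval S" "\<forall>x\<in>S. 0 < w x" "locally_L1 S w"
    and t: "form_of_op (weighted S w) T Q t" and f: "f \<in> Q"
    and I: "b < c" "{b<..<c} \<subseteq> C" "C \<subseteq> {b..c}" "C \<subseteq> S"
    and C: "restrict f C \<in> dirichlet_dom S w Q C"
  shows "restrict f {b<..<c} \<in> dirichlet_dom S w Q {b<..<c}"
    and "dirichlet_form t {b<..<c} (restrict f {b<..<c}) = dirichlet_form t C (restrict f C)"
proof -
  let ?I = "{b<..<c}" and ?M = "weighted S w"
  have w_meas: "w \<in> borel_measurable (lebesgue_on S)" by (rule locally_L1_borel_measurable[OF S(1,3)])
  have S_meas: "S \<in> sets lebesgue" using S(1) by (simp add: real_interval_borel_measurable)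
  have IS: "?I \<subseteq> S" using I by blast
  have extC: "zero_ext C f \<in> Q" using C by (simp add: dirichlet_dom_def)
  obtain u where u: "continuous_rep S (zero_ext C f) u" "\<forall>x\<in>frontier C \<inter> interior S. u x = 0"
    using C by (auto simp: dirichlet_dom_def)
  have "AE x in lebesgue_on S. x \<notin> {b, c}"
    by (rule AE_lebesgue_on_finite[OF _ S_meas]) simp
  moreover have "zero_ext C f x = zero_ext ?I f x" if "x \<notin> {b, c}" for x
  proof -
    have "x \<in> C \<longleftrightarrow> x \<in> ?I"
    proof
      assume "x \<in> C"
      then have "x \<in> {b..c}" using I(3) by blast
      then show "x \<in> ?I" using that by simp
    qed (use I(2) in blast)
    then show ?thesis by (simp add: zero_ext_def)
  qed
  ultimately have AE: "AE x in lebesgue_on S. zero_ext C f x = zero_ext ?I f x"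
    by (auto elim: eventually_mono)
  have "zero_ext C f \<in> borel_measurable (lebesgue_on S)"
    using form_of_op_subset_L2[OF t] extC by (auto simp: L2_def weighted_def)
  moreover have "zero_ext ?I f = (\<lambda>x. indicat_real ?I x *\<^sub>R zero_ext C f x)"
    by (rule ext) (use I(2) in \<open>auto simp: zero_ext_def indicator_def subset_iff\<close>)
  ultimately have "zero_ext ?I f \<in> borel_measurable ?M"
    unfolding weighted_def using S_meas IS
    by (auto intro!: borel_measurable_scaleR borel_measurable_indicator simp: sets_restrict_space_iff)
  note * = form_of_op_cong_AE[OF t extC this AE_weighted[OF w_meas AE]]
  show "dirichlet_form t ?I (restrict f ?I) = dirichlet_form t C (restrict f C)"
    using *(2) by (simp add: dirichlet_form_def)
  \<comment> \<open>The open interval has no frontier points beyond those of \<open>C\<close>, so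
    the vanishing of \<open>u\<close> required for \<open>C\<close> covers the vanishing required
    for the interval.\<close>
  have "closure ?I \<subseteq> closure C" "interior C \<subseteq> interior {b..c}"
    by (intro closure_mono interior_mono I)+
  then have "frontier ?I \<subseteq> frontier C"
    using I(1) by (auto simp: frontier_def)
  moreover have "continuous_rep S (zero_ext ?I f) u"
    using u(1) AE unfolding continuous_rep_def by (auto elim: eventually_elim2)
  moreover have "restrict f ?I \<in> L2 (weighted ?I w)"
    using L2_restrict[OF w_meas S(2) S_meas _ IS] form_of_op_subset_L2[OF t] f by auto
  ultimately show "restrict f ?I \<in> dirichlet_dom S w Q ?I"
    using *(1) u(2) unfolding dirichlet_dom_def by auto
qed

text \<open>A gap-free set \<open>J\<close> of integers indexes finite, one-sided and two-sided
  families alike, and an interval exists for each \<open>j\<close> with both \<open>j\<close> and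
  \<open>j + 1\<close> in \<open>J\<close>. Summability is asserted separately because
  \<open>infsum\<close> takes the default value 0 on families that are not summable.\<close>

theorem lemma3p5:
  fixes S :: "real set" and w p q :: "real \<Rightarrow> real"
    and T :: operator
    and Q :: "(real \<Rightarrow> complex) set" and t :: "(real \<Rightarrow> complex) \<Rightarrow> real"
    and J :: "int set" and a :: "int \<Rightarrow> real"
  assumes S: "is_interval S"
    and w_pos: "\<forall>x\<in>S. 0 < w x" and p_pos: "\<forall>x\<in>S. 0 < p x"
    and w_L1: "locally_L1 S w" and p_L1: "locally_L1 S (\<lambda>x. 1 / p x)" and q_L1: "locally_L1 S q"
    and T_sa: "self_adjoint (weighted S w) T" and T_pos: "positive_op (weighted S w) T"
    and T_SL: "\<forall>(f, g)\<in>T. sturm_liouville S w p q f g"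
    and t_form: "form_of_op (weighted S w) T Q t"
    and F_left: "\<not> regular_left S w p q \<Longrightarrow> friedrichs_left S w T Q t"
    and F_right: "\<not> regular_right S w p q \<Longrightarrow> friedrichs_right S w T Q t"
    and cont_rep: "\<forall>f\<in>Q. \<exists>u. continuous_rep S f u"
    and loc: "local_form S w Q t"
    and J: "\<forall>i\<in>J. \<forall>k\<in>J. {i..k} \<subseteq> J"
    and a_mono: "strict_mono_on J a" and a_S: "a ` J \<subseteq> S"
    and a_acc: "\<forall>x\<in>interior S. \<not> x islimpt a ` J"
  shows "\<forall>f\<in>Q. (\<exists>u. continuous_rep S f u \<and> (\<forall>j\<in>J. a j \<in> interior S \<longrightarrow> u (a j) = 0)) \<longrightarrow>
      (\<forall>j\<in>{j\<in>J. j + 1 \<in> J}. restrict f {a j<..<a (j + 1)} \<in> dirichlet_dom S w Q {a j<..<a (j + 1)}) \<and>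
      (\<lambda>j. dirichlet_form t {a j<..<a (j + 1)} (restrict f {a j<..<a (j + 1)}))
        summable_on {j\<in>J. j + 1 \<in> J} \<and>
      t f \<ge> (\<Sum>\<^sub>\<infinity>j\<in>{j\<in>J. j + 1 \<in> J}.
        dirichlet_form t {a j<..<a (j + 1)} (restrict f {a j<..<a (j + 1)}))"
proof (intro ballI impI)
  fix f assume f: "f \<in> Q"
    and "\<exists>u. continuous_rep S f u \<and> (\<forall>j\<in>J. a j \<in> interior S \<longrightarrow> u (a j) = 0)"
  then obtain u where u: "continuous_rep S f u" "\<forall>j\<in>J. a j \<in> interior S \<longrightarrow> u (a j) = 0" by blast
  let ?J = "{j\<in>J. j + 1 \<in> J}" and ?I = "\<lambda>j. {a j<..<a (j + 1)}"
  let ?t = "\<lambda>j. dirichlet_form t (?I j) (restrict f (?I j))"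
  \<comment> \<open>Locality allows only finitely many zeros, hence the passage through finite
    \<open>K\<close>. Singletons will give the domain claim, and all finite \<open>K\<close>
    together the bound on the infinite sum.\<close>
  have fin: "(\<forall>j\<in>K. restrict f (?I j) \<in> dirichlet_dom S w Q (?I j)) \<and> sum ?t K \<le> t f"
    if K: "finite K" "K \<subseteq> ?J" for K
  proof -
    define F where "F = a ` (K \<union> (\<lambda>j. j + 1) ` K) \<inter> interior S"
    have F: "finite F" "F \<subseteq> interior S" "\<forall>x\<in>F. u x = 0" "F \<subseteq> a ` J"
      using K u(2) by (auto simp: F_def)
    have less: "a j < a (j + 1)" if "j \<in> K" for j
      using a_mono that K by (auto simp: strict_mono_on_def)
    \<comment> \<open>By strict monotonicity, a value between neighbours would need an integer index
      strictly between \<open>j\<close> and \<open>j + 1\<close>.\<close>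
    have gap: "a ` J \<inter> ?I j = {}" if "j \<in> K" for j
    proof -
      have False if "i \<in> J" "a j < a i" "a i < a (j + 1)" for i
      proof -
        have "j < i" "i < j + 1"
          using that \<open>j \<in> K\<close> K strict_mono_on_less[OF a_mono] by auto
        then show False by simp
      qed
      then show ?thesis by auto
    qed
    have loc_f: "(\<forall>I\<in>components (S - F). restrict f I \<in> dirichlet_dom S w Q I) \<and>
        t f = (\<Sum>I\<in>components (S - F). dirichlet_form t I (restrict f I))"
      using loc f F u(1) unfolding local_form_def by blast
    have "\<exists>C. C \<in> components (S - F) \<and> ?I j \<subseteq> C \<and> C \<subseteq> {a j..a (j + 1)}" if j: "j \<in> K" for j
    proof -
      have "a j \<in> S" "a (j + 1) \<in> S" using j K a_S by auto
      moreover have "F \<inter> ?I j = {}" using gap[OF j] F(4) by blast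
      moreover have "{a j, a (j + 1)} \<inter> interior S \<subseteq> F" using j by (auto simp: F_def)
      ultimately show ?thesis using component_within_gap[OF S _ _ less[OF j]] by metis
    qed
    then obtain C where C: "\<And>j. j \<in> K \<Longrightarrow> C j \<in> components (S - F)"
        "\<And>j. j \<in> K \<Longrightarrow> ?I j \<subseteq> C j" "\<And>j. j \<in> K \<Longrightarrow> C j \<subseteq> {a j..a (j + 1)}"
      by metis
    have C_S: "C j \<subseteq> S" if "j \<in> K" for j using in_components_subset[OF C(1)[OF that]] by blast
    have dir: "restrict f (?I j) \<in> dirichlet_dom S w Q (?I j)"
        "?t j = dirichlet_form t (C j) (restrict f (C j))" if "j \<in> K" for j
      using dirichlet_open_interval[OF S w_pos w_L1 t_form f less[OF that] C(2)[OF that] C(3)[OF that] C_S[OF that]]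
        loc_f C(1)[OF that] by blast+
    \<comment> \<open>Distinct indices must not share a component, or its form value would be
      counted twice. If \<open>j < k\<close>, the midpoint of the \<open>j\<close>-th interval lies
      left of \<open>a (j + 1) \<le> a k\<close>, while \<open>C k\<close> lies right of
      \<open>a k\<close>.\<close>
    have "inj_on C K"
    proof (rule inj_onI)
      have le: "k \<le> j" if "j \<in> K" "k \<in> K" "C j = C k" for j k
      proof (rule ccontr)
        assume "\<not> k \<le> j"
        then have "a (j + 1) \<le> a k"
          using that K strict_mono_on_leD[OF a_mono, of "j + 1" k] by auto
        moreover have "(a j + a (j + 1)) / 2 \<in> {a k..a (k + 1)}"
          using C(2)[OF that(1)] C(3)[OF that(2)] that(3) less[OF that(1)] by fastforce
        ultimately show False using less[OF that(1)] by simp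
      qed
      then show "j = k" if "j \<in> K" "k \<in> K" "C j = C k" for j k using that by (metis antisym)
    qed
    then have "sum ?t K = (\<Sum>I\<in>C ` K. dirichlet_form t I (restrict f I))"
      using dir(2) by (simp add: sum.reindex)
    \<comment> \<open>The components that come from no index in \<open>K\<close> contribute
      nonnegative terms, since locality puts their zero extensions into \<open>Q\<close>.\<close>
    also have "\<dots> \<le> (\<Sum>I\<in>components (S - F). dirichlet_form t I (restrict f I))"
    proof (rule sum_mono2)
      show "finite (components (S - F))" by (rule finite_components_interval_minus_finite[OF S F(1)])
      show "C ` K \<subseteq> components (S - F)" using C(1) by blast
      show "0 \<le> dirichlet_form t I (restrict f I)" if "I \<in> components (S - F) - C ` K" for I
      proof -
        have "zero_ext I (restrict f I) \<in> Q" using loc_f that unfolding dirichlet_dom_def by blast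
        then show ?thesis unfolding dirichlet_form_def by (rule form_of_op_nonneg[OF t_form])
      qed
    qed
    finally show ?thesis using loc_f dir(1) by simp
  qed
  have dom: "\<forall>j\<in>?J. restrict f (?I j) \<in> dirichlet_dom S w Q (?I j)"
    using fin[of "{_}"] by auto
  then have nonneg: "0 \<le> ?t j" if "j \<in> ?J" for j
    using that form_of_op_nonneg[OF t_form] unfolding dirichlet_dom_def dirichlet_form_def by blast
  \<comment> \<open>For nonnegative terms, a common bound \<open>t f\<close> on the finite partial
    sums yields summability, and the same bound passes to the infinite sum.\<close>
  have "?t summable_on ?J"
    using nonneg fin by (intro nonneg_bdd_above_summable_on bdd_aboveI[where M = "t f"]) auto
  moreover from this have "infsum ?t ?J \<le> t f"
    using fin by (intro infsum_le_finite_sums) auto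
  ultimately show "(\<forall>j\<in>?J. restrict f (?I j) \<in> dirichlet_dom S w Q (?I j)) \<and>
      ?t summable_on ?J \<and> infsum ?t ?J \<le> t f"
    using dom by blast
qed

end
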